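(* Let $b>0$ and let $\Delta>0$ be a constant (independent of $d$). If the robots can only travel at speeds from a finite set, then there is no feasible solution to problem $\mathcal{W}(b,\Delta)$ nor to problem $\overline{\mathcal{W}}(b,\Delta)$; i.e., no such algorithm evacuates both robots for every instance $d$ while keeping the makespan (respectively total) evacuation energy at most $\Delta$.
   Context: Two robots start at the origin of the infinite real line. An exit is placed at an unknown point at distance $d>0$ from the origin (either at $d$ or at $-d$; either placement is called an instance $d$). A robot finds the exit if and only if it walks over it. Robots may change speed and direction at any time, and communicate wirelessly: messages are transmitted instantaneously at any distance. The evacuation time is the time at which the last robot reaches the exit. A robot moving at constant speed $s$ over a segment of length $x$ uses energy $xs^2$; moving in one direction from $a$ to $b$ with speed $s(x)$ at position $x$ uses $\int_a^b s(x)^2\,dx$, and energies of successive intervals add up. The total (respectively makespan) evacuation energy is the sum (respectively maximum) of the two robots' energies used until both have reached the exit. Problem $\overline{\mathcal{W}}(b,\Delta)$: minimize the evacuation time over algorithms using speeds at most $b$ whose total evacuation energy is at most $\Delta$ for every instance $d$. Problem $\mathcal{W}(b,\Delta)$: the same with the makespan evacuation energy bounded by $\Delta$. A feasible solution is an algorithm that satisfies these constraints and in which both robots eventually reach the exit for every instance. *)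

theory Defs
  imports "HOL-Analysis.Analysis"
begin

datatype robot = Robot1 | Robot2

type_synonym trajectory = "real \<Rightarrow> real"

text \<open>
  A trajectory maps times \<open>t \<ge> 0\<close> to positions on the line. An algorithm assigns to every exit
  position \<open>e \<noteq> 0\<close> the trajectories of the two robots when the exit is at \<open>e\<close>; the instance \<open>d > 0\<close>
  consists of the two placements \<open>e = d\<close> and \<open>e = -d\<close>.
\<close>

type_synonym algorithm = "real \<Rightarrow> robot \<Rightarrow> trajectory"

definition speed :: "trajectory \<Rightarrow> real \<Rightarrow> real" where
  "speed x t = \<bar>deriv x t\<bar>"

text \<open>
  Every passage over position \<open>y\<close> at time \<open>t\<close> contributes \<open>(speed x t)\<^sup>2\<close> per unit of length, so that
  a move in one direction uses the integral over positions of the squared speed and the energies of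
  successive moves add up; see \<open>energy_successive_moves\<close> below. Instead of fixing a
  list of moves in advance, this also covers infinitely many changes of speed and direction. For
  Lipschitz trajectories, positions passed at a time without derivative form a null set.
\<close>

definition passage_cost :: "trajectory \<Rightarrow> real set \<Rightarrow> real \<Rightarrow> ennreal" where
  "passage_cost x I y = (\<Sum>\<^sub>\<infinity>t\<in>{t\<in>I. x t = y}. ennreal ((speed x t)\<^sup>2))"

definition energy :: "trajectory \<Rightarrow> real \<Rightarrow> real \<Rightarrow> ennreal" where
  "energy x u w = (\<integral>\<^sup>+y. passage_cost x {u..w} y \<partial>lborel)"

lemma passage_cost_open_move:
  fixes x s :: "real \<Rightarrow> real"
  assumes uw: "u < w"
    and move: "(\<forall>t\<in>{u..w}. x t = x u) \<or>
      (continuous_on {u..w} x \<and>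
       (\<exists>\<sigma>\<in>{-1, 1}. \<forall>t\<in>{u<..<w}. s (x t) > 0 \<and> (x has_real_derivative \<sigma> * s (x t)) (at t)))"
    and y: "y \<noteq> x u" "y \<noteq> x w"
  shows "passage_cost x {u<..<w} y = ennreal ((s y)\<^sup>2) * indicator (closed_segment (x u) (x w)) y"
  using move
proof (elim disjE conjE bexE)
  assume const: "\<forall>t\<in>{u..w}. x t = x u"
  have "x t \<noteq> y" if "t \<in> {u<..<w}" for t
    using bspec[OF const, of t] that y by simp
  then have empty: "{t\<in>{u<..<w}. x t = y} = {}" by blast
  have "x w = x u" using bspec[OF const, of w] uw by simp
  then show ?thesis unfolding passage_cost_def empty using y by simp
next
  fix \<sigma> :: real
  assume cont: "continuous_on {u..w} x" and \<sigma>: "\<sigma> \<in> {-1, 1}"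
    and der: "\<forall>t\<in>{u<..<w}. s (x t) > 0 \<and> (x has_real_derivative \<sigma> * s (x t)) (at t)"
  have mono: "\<sigma> * x p < \<sigma> * x q" if "u \<le> p" "p < q" "q \<le> w" for p q
  proof (rule DERIV_pos_imp_increasing_open[OF that(2)])
    fix t assume t: "p < t" "t < q"
    with that der have "s (x t) > 0" "(x has_real_derivative \<sigma> * s (x t)) (at t)" by auto
    then have "((\<lambda>t. \<sigma> * x t) has_real_derivative \<sigma> * (\<sigma> * s (x t))) (at t)"
      by (intro DERIV_cmult)
    moreover have "\<sigma> * (\<sigma> * s (x t)) > 0"
      using \<sigma> \<open>s (x t) > 0\<close> by auto
    ultimately show "\<exists>D. ((\<lambda>t. \<sigma> * x t) has_real_derivative D) (at t) \<and> 0 < D" by blast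
  next
    show "continuous_on {p..q} (\<lambda>t. \<sigma> * x t)"
      using that by (intro continuous_intros continuous_on_subset[OF cont]) auto
  qed
  have in_seg: "x t \<in> closed_segment (x u) (x w)" if "t \<in> {u<..<w}" for t
  proof -
    have "\<sigma> * x u < \<sigma> * x t" "\<sigma> * x t < \<sigma> * x w" using mono that by auto
    then show ?thesis using \<sigma> by (auto simp: closed_segment_eq_real_ivl)
  qed
  show ?thesis
  proof (cases "y \<in> closed_segment (x u) (x w)")
    case True
    have "\<exists>t. u \<le> t \<and> t \<le> w \<and> x t = y"
    proof (cases "x u \<le> x w")
      case le: True
      then show ?thesis
        using True uw by (intro IVT' cont) (simp_all add: closed_segment_eq_real_ivl)
    next
      case False
      then show ?thesis
        using True uw by (intro IVT2' cont) (simp_all add: closed_segment_eq_real_ivl)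
    qed
    then obtain t where t: "u \<le> t" "t \<le> w" "x t = y" by blast
    with y have t': "t \<in> {u<..<w}" by (metis greaterThanLessThan_iff less_le)
    have single: "{t\<in>{u<..<w}. x t = y} = {t}"
    proof (intro equalityI subsetI)
      fix r assume "r \<in> {t\<in>{u<..<w}. x t = y}"
      then have r: "u < r" "r < w" "x r = x t" using t(3) by auto
      then have "\<not> r < t" "\<not> t < r" using mono[of r t] mono[of t r] t(1,2) by auto
      then show "r \<in> {t}" by simp
    qed (use t t' in auto)
    have "speed x t = s y"
    proof -
      have pos: "s y > 0" and "(x has_real_derivative \<sigma> * s y) (at t)" using der t' t(3) by blast+
      then have "deriv x t = \<sigma> * s y" by (intro DERIV_imp_deriv)
      then show ?thesis using pos \<sigma> by (auto simp: speed_def)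
    qed
    then show ?thesis unfolding passage_cost_def single using True by simp
  next
    case False
    then have empty: "{t\<in>{u<..<w}. x t = y} = {}" using in_seg by auto
    show ?thesis unfolding passage_cost_def empty using False by simp
  qed
qed

lemma energy_successive_moves:
  fixes x :: trajectory and s :: "nat \<Rightarrow> real \<Rightarrow> real" and \<tau> :: "nat \<Rightarrow> real"
  assumes \<tau>: "\<And>i. i < n \<Longrightarrow> \<tau> i < \<tau> (Suc i)"
    and meas: "\<And>i. i < n \<Longrightarrow> s i \<in> borel_measurable borel"
    and move: "\<And>i. i < n \<Longrightarrow> (\<forall>t\<in>{\<tau> i..\<tau> (Suc i)}. x t = x (\<tau> i)) \<or>
      (continuous_on {\<tau> i..\<tau> (Suc i)} x \<and>
       (\<exists>\<sigma>\<in>{-1, 1}. \<forall>t\<in>{\<tau> i<..<\<tau> (Suc i)}.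
          s i (x t) > 0 \<and> (x has_real_derivative \<sigma> * s i (x t)) (at t)))"
  shows "energy x (\<tau> 0) (\<tau> n) =
    (\<Sum>i<n. \<integral>\<^sup>+y\<in>closed_segment (x (\<tau> i)) (x (\<tau> (Suc i))). ennreal ((s i y)\<^sup>2) \<partial>lborel)"
proof -
  define N where "N = (\<lambda>i. x (\<tau> i)) ` {..n}"
  have ptw: "\<tau> 0 \<le> \<tau> m \<and> passage_cost x {\<tau> 0..\<tau> m} y =
      (\<Sum>i<m. ennreal ((s i y)\<^sup>2) * indicator (closed_segment (x (\<tau> i)) (x (\<tau> (Suc i)))) y)"
    if "m \<le> n" "y \<notin> N" for m y
    using that(1)
  proof (induction m)
    case 0
    have "x (\<tau> 0) \<noteq> y" using that(2) by (auto simp: N_def)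
    then have empty: "{t\<in>{\<tau> 0..\<tau> 0}. x t = y} = {}" by auto
    show ?case unfolding passage_cost_def empty by simp
  next
    case (Suc m)
    have ne: "y \<noteq> x (\<tau> m)" "y \<noteq> x (\<tau> (Suc m))" using Suc.prems that(2) by (auto simp: N_def)
    have lt: "\<tau> m < \<tau> (Suc m)" and le: "\<tau> 0 \<le> \<tau> m" using Suc \<tau>[of m] by auto
    have "{t\<in>{\<tau> 0..\<tau> (Suc m)}. x t = y} =
        {t\<in>{\<tau> 0..\<tau> m}. x t = y} \<union> {t\<in>{\<tau> m<..<\<tau> (Suc m)}. x t = y}"
      using ne lt le by force
    then have "passage_cost x {\<tau> 0..\<tau> (Suc m)} y =
        passage_cost x {\<tau> 0..\<tau> m} y + passage_cost x {\<tau> m<..<\<tau> (Suc m)} y"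
      unfolding passage_cost_def
      by (simp only:) (rule infsum_Un_disjoint, auto intro: nonneg_summable_on_complete)
    also have "passage_cost x {\<tau> m<..<\<tau> (Suc m)} y =
        ennreal ((s m y)\<^sup>2) * indicator (closed_segment (x (\<tau> m)) (x (\<tau> (Suc m)))) y"
      using Suc.prems by (intro passage_cost_open_move lt move ne) auto
    finally show ?case using Suc le lt by simp
  qed
  have "AE y in lborel. y \<notin> N"
    by (intro AE_not_in finite_imp_null_set_lborel) (simp add: N_def)
  then have "energy x (\<tau> 0) (\<tau> n) = (\<integral>\<^sup>+y. (\<Sum>i<n. ennreal ((s i y)\<^sup>2) *
      indicator (closed_segment (x (\<tau> i)) (x (\<tau> (Suc i)))) y) \<partial>lborel)"
    unfolding energy_def by (intro nn_integral_cong_AE, elim eventually_mono) (use ptw in blast)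
  also have "\<dots> =
    (\<Sum>i<n. \<integral>\<^sup>+y\<in>closed_segment (x (\<tau> i)) (x (\<tau> (Suc i))). ennreal ((s i y)\<^sup>2) \<partial>lborel)"
    using meas by (intro nn_integral_sum borel_measurable_times_ennreal measurable_compose[OF _ measurable_ennreal]
       borel_measurable_power borel_measurable_indicator) auto
  finally show ?thesis .
qed

definition undiscovered :: "algorithm \<Rightarrow> real \<Rightarrow> real \<Rightarrow> bool" where
  "undiscovered A e t \<longleftrightarrow> (\<forall>r. \<forall>t'\<in>{0..t}. A e r t' \<noteq> e)"

text \<open>
  The exit position is unknown until a robot walks over it, so two runs may differ only after the
  exit has been found in one of them. From then on, by instantaneous communication, the motion of
  both robots may depend on the exit.
\<close>

definition online :: "algorithm \<Rightarrow> bool" where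
  "online A \<longleftrightarrow> (\<forall>e e' t. e \<noteq> 0 \<longrightarrow> e' \<noteq> 0 \<longrightarrow> 0 \<le> t \<longrightarrow>
     undiscovered A e t \<longrightarrow> undiscovered A e' t \<longrightarrow> (\<forall>r. A e r t = A e' r t))"

text \<open>Speed at most \<open>b\<close> at all times is \<open>b\<close>-Lipschitz continuity of the trajectory.\<close>

definition evacuation_algorithm :: "real \<Rightarrow> algorithm \<Rightarrow> bool" where
  "evacuation_algorithm b A \<longleftrightarrow> online A \<and>
     (\<forall>e r. e \<noteq> 0 \<longrightarrow> A e r 0 = 0 \<and> b-lipschitz_on {0..} (A e r) \<and> (\<exists>t\<ge>0. A e r t = e))"

definition reach_time :: "algorithm \<Rightarrow> real \<Rightarrow> robot \<Rightarrow> real" where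
  "reach_time A e r = Inf {t. 0 \<le> t \<and> A e r t = e}"

definition evacuation_time :: "algorithm \<Rightarrow> real \<Rightarrow> real" where
  "evacuation_time A e = max (reach_time A e Robot1) (reach_time A e Robot2)"

definition robot_energy :: "algorithm \<Rightarrow> real \<Rightarrow> robot \<Rightarrow> ennreal" where
  "robot_energy A e r = energy (A e r) 0 (evacuation_time A e)"

definition total_energy :: "algorithm \<Rightarrow> real \<Rightarrow> ennreal" where
  "total_energy A e = robot_energy A e Robot1 + robot_energy A e Robot2"

definition makespan_energy :: "algorithm \<Rightarrow> real \<Rightarrow> ennreal" where
  "makespan_energy A e = max (robot_energy A e Robot1) (robot_energy A e Robot2)"

definition feasible_W :: "real \<Rightarrow> real \<Rightarrow> algorithm \<Rightarrow> bool" where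
  "feasible_W b \<Delta> A \<longleftrightarrow>
     evacuation_algorithm b A \<and> (\<forall>e. e \<noteq> 0 \<longrightarrow> makespan_energy A e \<le> ennreal \<Delta>)"

definition feasible_W_bar :: "real \<Rightarrow> real \<Rightarrow> algorithm \<Rightarrow> bool" where
  "feasible_W_bar b \<Delta> A \<longleftrightarrow>
     evacuation_algorithm b A \<and> (\<forall>e. e \<noteq> 0 \<longrightarrow> total_energy A e \<le> ennreal \<Delta>)"

text \<open>
  Standing still is always allowed. The condition holds for almost all times because a trajectory has
  no speed at the times where its speed or direction jumps.
\<close>

definition travels_at_speeds :: "real set \<Rightarrow> algorithm \<Rightarrow> bool" where
  "travels_at_speeds V A \<longleftrightarrow> (\<forall>e r. e \<noteq> 0 \<longrightarrow>
     (AE t in lborel. 0 \<le> t \<longrightarrow>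
        A e r differentiable (at t) \<and> speed (A e r) t \<in> insert 0 V))"

end

theory Submission
  imports Defs
begin

text \<open>
  Let \<open>m > 0\<close> be a lower bound for the positive speeds in \<open>V\<close>. On its way to the exit \<open>e\<close> a robot
  passes every position between \<open>0\<close> and \<open>e\<close>. Almost every such position is passed at a time at which
  the speed exists, lies in \<open>V\<close> and is nonzero: a Lipschitz map sends the null set of bad times to
  a null set, and the critical values form a null set by Sard's theorem. So the robot uses energy at
  least \<open>m\<^sup>2 \<bar>e\<bar>\<close>, which is unbounded in \<open>e\<close>.
\<close>

lemma negligible_critical_values_real:
  fixes f :: "real \<Rightarrow> real"
  assumes der: "\<And>t. t \<in> S \<Longrightarrow> (f has_real_derivative 0) (at t within S)"
  shows "negligible (f ` S)"
proof -
  \<comment> \<open>Dimension one of \<open>baby_Sard\<close>: \<open>g\<close> is \<open>f\<close>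
    carried over to \<open>real^1\<close>, where the zero derivative has rank 0, below the dimension
    1.\<close>
  define g :: "real^1 \<Rightarrow> real^1" where "g = (\<lambda>v. vec (f (v $ 1)))"
  have "negligible (g ` vec ` S)"
  proof (rule baby_Sard[where f' = "\<lambda>_ _. 0"])
    fix v :: "real^1" assume "v \<in> vec ` S"
    then have "v $ 1 \<in> S" by auto
    have img: "(\<lambda>v::real^1. v $ 1) ` vec ` S = S"
      by (auto simp: image_iff)
    have "(f has_derivative (\<lambda>_. 0)) (at (v $ 1) within (\<lambda>v::real^1. v $ 1) ` vec ` S)"
      unfolding img using der[OF \<open>v $ 1 \<in> S\<close>] by (simp add: has_field_derivative_def lambda_zero)
    moreover have "((\<lambda>v::real^1. v $ 1) has_derivative (\<lambda>v. v $ 1)) (at v within vec ` S)"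
      by (intro bounded_linear_imp_has_derivative bounded_linear_vec_nth)
    ultimately have "((\<lambda>v. f (v $ 1)) has_derivative (\<lambda>_. 0)) (at v within vec ` S)"
      by (rule has_derivative_in_compose[rotated])
    moreover have "bounded_linear (vec :: real \<Rightarrow> real^1)"
      by (simp add: linear_conv_bounded_linear[symmetric] linear_vec)
    ultimately show "(g has_derivative (\<lambda>_. 0)) (at v within vec ` S)"
      unfolding g_def using bounded_linear.has_derivative[of vec] by fastforce
    show "rank (matrix (\<lambda>_::real^1. 0::real^1)) < CARD(1)"
      by (simp add: matrix_def rank_0 flip: zero_vec_def)
  qed simp
  \<comment> \<open>The coordinate map from \<open>real^1\<close> to the reals is linear between
    spaces of equal dimension, so it keeps the image negligible.\<close>
  then have "negligible ((\<lambda>v::real^1. v $ 1) ` g ` vec ` S)"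
    by (rule negligible_differentiable_image_negligible[rotated])
       (auto intro!: linear_imp_differentiable_on bounded_linear.linear bounded_linear_vec_nth)
  then show ?thesis
    by (simp add: g_def image_image)
qed

lemma lipschitz_on_negligible_image:
  fixes f :: "real \<Rightarrow> real"
  assumes "b-lipschitz_on S f" "negligible S"
  shows "negligible (f ` S)"
proof (rule negligible_locally_Lipschitz_image)
  show "\<exists>T B. open T \<and> t \<in> T \<and> (\<forall>s\<in>S \<inter> T. norm (f s - f t) \<le> B * norm (s - t))" if "t \<in> S" for t
    using that assms(1) by (intro exI[of _ UNIV] exI[of _ b]) (auto simp: lipschitz_on_def dist_norm)
qed (use assms in auto)

lemma speed_le_passage_cost:
  assumes "t \<in> I" "x t = y"
  shows "ennreal ((speed x t)\<^sup>2) \<le> passage_cost x I y"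
proof -
  have "infsum (\<lambda>t. ennreal ((speed x t)\<^sup>2)) {t} \<le> passage_cost x I y"
    unfolding passage_cost_def by (rule infsum_mono_neutral) (use assms in \<open>auto intro: nonneg_summable_on_complete\<close>)
  then show ?thesis by simp
qed

text \<open>By continuity every position between \<open>x u\<close> and \<open>x s\<close> is
  passed, and almost every one costs at least \<open>m\<^sup>2\<close>. The time \<open>s\<close> is
  separate from \<open>w\<close> because energy is counted until both robots have arrived, and a
  robot may move on after its own arrival.\<close>

lemma energy_ge_displacement:
  fixes x :: trajectory
  assumes lip: "b-lipschitz_on {u..w} x" and m: "m \<ge> 0"
    and speed: "AE t in lborel. t \<in> {u..w} \<longrightarrow>
      x differentiable (at t) \<and> (speed x t = 0 \<or> m \<le> speed x t)"
    and s: "s \<in> {u..w}"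
  shows "ennreal (m\<^sup>2 * \<bar>x s - x u\<bar>) \<le> energy x u w"
proof -
  \<comment> \<open>\<open>G\<close> collects the times with an admissible speed. Times in
    \<open>Z\<close> may lie in \<open>G\<close>, but there the speed is 0 and the passage
    contributes nothing, so their positions are discarded too.\<close>
  define G where "G = {t. x differentiable (at t) \<and> (speed x t = 0 \<or> m \<le> speed x t)}"
  define Z where "Z = {t\<in>{u..w}. (x has_real_derivative 0) (at t)}"
  have "{t\<in>{u..w}. t \<notin> G} \<in> null_sets lebesgue"
    using AE_completion[OF speed] by (simp add: completion.AE_iff_null_sets G_def)
  then have "negligible (x ` {t\<in>{u..w}. t \<notin> G})"
    by (intro lipschitz_on_negligible_image[OF lipschitz_on_subset[OF lip]])
       (auto simp: negligible_iff_null_sets)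
  moreover have "negligible (x ` Z)"
    by (rule negligible_critical_values_real) (auto simp: Z_def intro: has_field_derivative_at_within)
  ultimately have "x ` {t\<in>{u..w}. t \<notin> G} \<union> x ` Z \<in> null_sets lebesgue"
    by (simp flip: negligible_iff_null_sets)
  \<comment> \<open>The bad positions are Lebesgue null; an almost-everywhere statement for the
    completion is one for \<open>lborel\<close>, the measure in \<open>energy\<close>.\<close>
  then have "AE y in lborel. y \<notin> x ` {t\<in>{u..w}. t \<notin> G} \<union> x ` Z"
    by (subst AE_completion_iff[symmetric]) (rule AE_not_in)
  then have "AE y in lborel.
      ennreal (m\<^sup>2) * indicator (closed_segment (x u) (x s)) y \<le> passage_cost x {u..w} y"
  proof (rule eventually_mono)
    fix y assume y: "y \<notin> x ` {t\<in>{u..w}. t \<notin> G} \<union> x ` Z"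
    show "ennreal (m\<^sup>2) * indicator (closed_segment (x u) (x s)) y \<le> passage_cost x {u..w} y"
    proof (cases "y \<in> closed_segment (x u) (x s)")
      case True
      have "connected (x ` {u..s})"
        using s by (intro connected_continuous_image
            continuous_on_subset[OF lipschitz_on_continuous_on[OF lip]]) auto
      then have "closed_segment (x u) (x s) \<subseteq> x ` {u..s}"
        using s by (intro closed_segment_subset) (auto simp flip: is_interval_connected_1 is_interval_convex_1)
      then obtain t where t: "t \<in> {u..w}" "x t = y"
        using True s by fastforce
      then have "t \<in> G" "t \<notin> Z" using y by auto
      \<comment> \<open>Speed 0 at a time in \<open>G\<close> would mean derivative 0, putting
        \<open>t\<close> into \<open>Z\<close>.\<close>
      then have "m \<le> speed x t"
        using t by (auto simp: G_def Z_def speed_def DERIV_deriv_iff_real_differentiable[symmetric])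
      then have "ennreal (m\<^sup>2) \<le> ennreal ((speed x t)\<^sup>2)"
        using m by (intro ennreal_leI power_mono) auto
      also have "\<dots> \<le> passage_cost x {u..w} y"
        using t by (rule speed_le_passage_cost)
      finally show ?thesis using True by simp
    qed simp
  qed
  then have "(\<integral>\<^sup>+y. ennreal (m\<^sup>2) * indicator (closed_segment (x u) (x s)) y \<partial>lborel) \<le> energy x u w"
    unfolding energy_def by (rule nn_integral_mono_AE)
  moreover have "emeasure lborel (closed_segment (x u) (x s)) = ennreal \<bar>x s - x u\<bar>"
    by (auto simp: closed_segment_eq_real_ivl)
  ultimately show ?thesis
    by (simp add: nn_integral_cmult_indicator ennreal_mult' closed_segment_eq_real_ivl split: if_splits)
qed

text \<open>The infimum is a minimum: the set of arrival times is closed by continuity, nonempty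
  because the robot reaches the exit, and bounded below by 0.\<close>

lemma reach_time_attained:
  assumes "evacuation_algorithm b A" "e \<noteq> 0"
  shows "0 \<le> reach_time A e r" "A e r (reach_time A e r) = e"
proof -
  let ?R = "{t. 0 \<le> t \<and> A e r t = e}"
  have "continuous_on {0..} (A e r)" and ne: "?R \<noteq> {}"
    using assms by (auto simp: evacuation_algorithm_def intro: lipschitz_on_continuous_on)
  then have "closed ({0..} \<inter> A e r -` {e})"
    by (intro continuous_closed_preimage) auto
  then have "closed ?R" by (simp add: vimage_def Int_def)
  moreover have "bdd_below ?R" by (rule bdd_belowI[of _ 0]) auto
  ultimately have "Inf ?R \<in> ?R" using ne by (intro closed_contains_Inf)
  then show "0 \<le> reach_time A e r" "A e r (reach_time A e r) = e"
    by (auto simp: reach_time_def)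
qed

text \<open>One robot suffices for both problems, since its energy is at most the makespan energy
  and at most the total energy.\<close>

lemma robot_energy_unbounded:
  assumes V: "finite V" "travels_at_speeds V A" and A: "evacuation_algorithm b A" and "\<Delta> > 0"
  shows "\<exists>e. e \<noteq> 0 \<and> ennreal \<Delta> < robot_energy A e Robot1"
proof -
  \<comment> \<open>The inserted 1 keeps the set nonempty, so \<open>m\<close> is positive even if
    \<open>V\<close> has no positive speed.\<close>
  define m where "m = Min (insert 1 {v\<in>V. v > 0})"
  have "m > 0" and m_le: "\<And>v. v \<in> V \<Longrightarrow> v > 0 \<Longrightarrow> m \<le> v"
    using V by (auto simp: m_def)
  \<comment> \<open>Chosen so that \<open>m\<^sup>2 * e\<close> equals
    \<open>\<Delta> + m\<^sup>2\<close>, which exceeds the budget.\<close>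
  define e where "e = \<Delta> / m\<^sup>2 + 1"
  have "e > 0" using \<open>\<Delta> > 0\<close> \<open>m > 0\<close> by (simp add: e_def add_nonneg_pos)
  let ?x = "A e Robot1" and ?T = "evacuation_time A e" and ?s = "reach_time A e Robot1"
  have s: "0 \<le> ?s" "?x ?s = e" "?s \<le> ?T"
    using reach_time_attained[OF A, of e Robot1] \<open>e > 0\<close> by (auto simp: evacuation_time_def)
  have start: "?x 0 = 0" and lip: "b-lipschitz_on {0..} ?x"
    using A \<open>e > 0\<close> by (auto simp: evacuation_algorithm_def)
  have "AE t in lborel. 0 \<le> t \<longrightarrow> ?x differentiable (at t) \<and> speed ?x t \<in> insert 0 V"
    using V \<open>e > 0\<close> by (auto simp: travels_at_speeds_def)
  then have "AE t in lborel. t \<in> {0..?T} \<longrightarrow>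
      ?x differentiable (at t) \<and> (speed ?x t = 0 \<or> m \<le> speed ?x t)"
  proof (rule eventually_mono)
    fix t assume "0 \<le> t \<longrightarrow> ?x differentiable (at t) \<and> speed ?x t \<in> insert 0 V"
    moreover have "speed ?x t \<ge> 0" by (simp add: speed_def)
    ultimately show "t \<in> {0..?T} \<longrightarrow>
        ?x differentiable (at t) \<and> (speed ?x t = 0 \<or> m \<le> speed ?x t)"
      using m_le[of "speed ?x t"] by (auto simp: less_le)
  qed
  then have "ennreal (m\<^sup>2 * \<bar>?x ?s - ?x 0\<bar>) \<le> energy ?x 0 ?T"
    using s \<open>m > 0\<close> by (intro energy_ge_displacement[OF lipschitz_on_subset[OF lip]]) auto
  moreover have "m\<^sup>2 * \<bar>?x ?s - ?x 0\<bar> = \<Delta> + m\<^sup>2"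
  proof -
    have "m\<^sup>2 * e = \<Delta> + m\<^sup>2" using \<open>m > 0\<close> by (simp add: e_def field_simps)
    then show ?thesis using s start \<open>e > 0\<close> by simp
  qed
  moreover have "ennreal \<Delta> < ennreal (\<Delta> + m\<^sup>2)"
    using \<open>m > 0\<close> \<open>\<Delta> > 0\<close> by (intro ennreal_lessI) (auto intro: add_pos_pos)
  ultimately have "ennreal \<Delta> < robot_energy A e Robot1"
    unfolding robot_energy_def by (simp add: order.strict_trans2)
  then show ?thesis using \<open>e > 0\<close> by (intro exI[of _ e]) simp
qed

theorem theorem3:
  fixes b \<Delta> :: real and V :: "real set"
  assumes "b > 0" and "\<Delta> > 0" and "finite V"
  shows "\<not> (\<exists>A. travels_at_speeds V A \<and> feasible_W b \<Delta> A) \<and>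
         \<not> (\<exists>A. travels_at_speeds V A \<and> feasible_W_bar b \<Delta> A)"
proof (intro conjI notI; elim exE conjE)
  fix A assume V: "travels_at_speeds V A" and A: "feasible_W b \<Delta> A"
  then obtain e where "e \<noteq> 0" "ennreal \<Delta> < robot_energy A e Robot1"
    using robot_energy_unbounded[OF \<open>finite V\<close> V _ \<open>\<Delta> > 0\<close>] by (auto simp: feasible_W_def)
  moreover have "makespan_energy A e \<le> ennreal \<Delta>"
    using A \<open>e \<noteq> 0\<close> by (simp add: feasible_W_def)
  ultimately show False by (auto simp: makespan_energy_def)
next
  fix A assume V: "travels_at_speeds V A" and A: "feasible_W_bar b \<Delta> A"
  then obtain e where "e \<noteq> 0" and gt: "ennreal \<Delta> < robot_energy A e Robot1"
    using robot_energy_unbounded[OF \<open>finite V\<close> V _ \<open>\<Delta> > 0\<close>] by (auto simp: feasible_W_bar_def)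
  have "robot_energy A e Robot1 \<le> total_energy A e"
    by (simp add: total_energy_def)
  also have "\<dots> \<le> ennreal \<Delta>"
    using A \<open>e \<noteq> 0\<close> by (simp add: feasible_W_bar_def)
  finally show False using gt by simp
qed

end
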